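(* Let $0\le\alpha\le 3-2\sqrt{2}$, let $f\in\mathcal{BS}(\alpha)$, and let $|z|=r<1$. Then $$\left(\frac{1-r\sqrt{\alpha}}{1+r\sqrt{\alpha}}\right)^{\frac{1}{2\sqrt{\alpha}}}\le\mathrm{Re}\left(\frac{f(z)}{z}\right)\le\left(\frac{1+r\sqrt{\alpha}}{1-r\sqrt{\alpha}}\right)^{\frac{1}{2\sqrt{\alpha}}}.$$ The result is sharp, i.e. for each such $\alpha$ and $r$ each of the two bounds is attained for some $f\in\mathcal{BS}(\alpha)$ and some $z$ with $|z|=r$.
   Context: $\Delta=\{z\in\mathbb{C}:|z|<1\}$, and $\mathcal{A}$ is the class of analytic functions $f$ on $\Delta$ with $f(0)=0$ and $f'(0)=1$. For analytic functions $f,g$ on $\Delta$, $f\prec g$ ($f$ is subordinate to $g$) means that there is an analytic function $w$ on $\Delta$ with $w(0)=0$ and $|w(z)|<1$ for all $z\in\Delta$ such that $f(z)=g(w(z))$ for all $z\in\Delta$. For $0\le\alpha<1$, $\mathcal{BS}(\alpha)$ is the class of $f\in\mathcal{A}$ such that $\frac{zf'(z)}{f(z)}-1\prec\frac{z}{1-\alpha z^2}$ in $\Delta$ (in particular $zf'(z)/f(z)$ is analytic in $\Delta$, with value $1$ at $z=0$). The function $f(z)/z$ takes the value $1$ at $z=0$. For $\alpha=0$ the lower and upper bounds are understood as their limits as $\alpha\to0^+$, namely $e^{-r}$ and $e^{r}$. *)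

theory Defs
  imports "HOL-Complex_Analysis.Complex_Analysis"
begin

abbreviation unit_disc :: "complex set" where
  "unit_disc \<equiv> ball 0 1"

definition class_A :: "(complex \<Rightarrow> complex) set" where
  "class_A = {f. f holomorphic_on unit_disc \<and> f 0 = 0 \<and> deriv f 0 = 1}"

definition subordinate :: "(complex \<Rightarrow> complex) \<Rightarrow> (complex \<Rightarrow> complex) \<Rightarrow> bool"
    (infix "\<prec>" 50) where
  "f \<prec> g \<longleftrightarrow> f holomorphic_on unit_disc \<and> g holomorphic_on unit_disc \<and>
     (\<exists>w. w holomorphic_on unit_disc \<and> w 0 = 0 \<and>
          (\<forall>z\<in>unit_disc. norm (w z) < 1) \<and>
          (\<forall>z\<in>unit_disc. f z = g (w z)))"

text \<open>The functions z f'(z) / f(z) and f(z) / z, each with its removable singularity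
  at the origin filled in for f in \<^const>\<open>class_A\<close>.\<close>

definition log_deriv_quot :: "(complex \<Rightarrow> complex) \<Rightarrow> complex \<Rightarrow> complex" where
  "log_deriv_quot f z = (if z = 0 then 1 else z * deriv f z / f z)"

definition quot_id :: "(complex \<Rightarrow> complex) \<Rightarrow> complex \<Rightarrow> complex" where
  "quot_id f z = (if z = 0 then 1 else f z / z)"

text \<open>The subordination requires z f'(z) / f(z) to be analytic on the disc, so f has no zero
  there besides the origin (z f'/f has a pole at any other zero of f). This is stated explicitly
  so that the definition does not hinge on the convention x / 0 = 0.\<close>

definition BS :: "real \<Rightarrow> (complex \<Rightarrow> complex) set" where
  "BS \<alpha> = {f \<in> class_A. (\<forall>z\<in>unit_disc - {0}. f z \<noteq> 0) \<and>
     (\<lambda>z. log_deriv_quot f z - 1) \<prec> (\<lambda>z. z / (1 - of_real \<alpha> * z ^ 2))}"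

text \<open>At \<alpha> = 0 the bounds are the limits for \<alpha> tending to 0 from above.\<close>

definition BS_lower :: "real \<Rightarrow> real \<Rightarrow> real" where
  "BS_lower \<alpha> r = (if \<alpha> = 0 then exp (- r)
     else ((1 - r * sqrt \<alpha>) / (1 + r * sqrt \<alpha>)) powr (1 / (2 * sqrt \<alpha>)))"

definition BS_upper :: "real \<Rightarrow> real \<Rightarrow> real" where
  "BS_upper \<alpha> r = (if \<alpha> = 0 then exp r
     else ((1 + r * sqrt \<alpha>) / (1 - r * sqrt \<alpha>)) powr (1 / (2 * sqrt \<alpha>)))"

end

theory Submission
  imports Defs
begin

text \<open>
  Put \<open>s = sqrt \<alpha>\<close>, \<open>F z = z / (1 - s\<^sup>2 z\<^sup>2)\<close> and \<open>q z = artanh (s z) / s\<close> (with \<open>q z = z\<close> for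
  \<open>s = 0\<close>), so that \<open>z q'(z) = F z\<close> and \<open>exp (q x)\<close> is the upper bound at a real point \<open>x\<close>, the
  lower bound being its value at \<open>- x\<close>. If \<open>f\<close> is in the class, then \<open>f z / z = exp (p z)\<close> with
  \<open>p 0 = 0\<close> and \<open>z p'(z) = F (w z)\<close> for some \<open>w\<close> mapping the disc into itself. Everything rests on
  two facts.

  First, \<open>p\<close> is subordinate to \<open>q\<close> (\<open>subordinate_scaled_artanh\<close>). Since \<open>q\<close> has the explicit
  inverse \<open>u \<mapsto> tanh (s u) / s\<close>, one can write \<open>p = q \<circ> \<omega>\<close> with \<open>\<omega> = tanh (s p) / s\<close> and has to
  show that \<open>\<omega>\<close> stays in the disc. If \<open>\<bar>\<omega>\<bar>\<close> reached 1, then Jack's lemma at a point \<open>z\<close> of least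
  modulus where this happens would give \<open>z \<omega>'(z) = m \<omega>(z)\<close> with \<open>m \<ge> 1\<close>, and hence
  \<open>F (w z) = m F (\<omega> z)\<close> with \<open>\<bar>w z\<bar> < 1 = \<bar>\<omega> z\<bar>\<close>. This contradicts the starlikeness of the image
  of the disc under \<open>F\<close> (\<open>kernel_starlike\<close>). Schwarz' lemma then yields \<open>\<bar>\<omega> z\<bar> \<le> \<bar>z\<bar>\<close>. The
  condition \<open>\<alpha> \<le> 3 - 2 sqrt 2\<close> is equivalent to \<open>2 s \<le> 1 - s\<^sup>2\<close>; combined with the elementary
  estimate \<open>\<bar>p z\<bar> \<le> \<bar>z\<bar> / (1 - s\<^sup>2)\<close> it keeps \<open>2 s p\<close> inside the unit disc, away from the poles
  of the hyperbolic tangent.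

  Second, the real part of \<open>G = exp \<circ> q\<close> decreases along the upper half of each circle about 0
  (\<open>Re_exp_scaled_artanh_antimono\<close>). This is the convexity of \<open>G\<close>: the argument of \<open>z G'(z)\<close>
  increases along the circle, and by symmetry it runs from 0 at \<open>r\<close> to \<open>\<pi>\<close> at \<open>- r\<close>, so
  \<open>Im (z G'(z)) \<ge> 0\<close> on the upper half. Hence \<open>Re G\<close> has its extreme values at \<open>\<plusminus> r\<close>.

  The function \<open>z exp (q z)\<close> belongs to the class and attains both bounds, at \<open>\<plusminus> r\<close>.
\<close>

section \<open>The convex map with derivative 1 / (1 - s^2 z^2) and its inverse\<close>

definition scaled_artanh :: "real \<Rightarrow> complex \<Rightarrow> complex" where
  "scaled_artanh s z =
     (if s = 0 then z else (Ln (1 + of_real s * z) - Ln (1 - of_real s * z)) / (2 * of_real s))"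

text \<open>The quotient is \<open>tanh (s u) / s\<close>. Written with \<open>exp (2 s u)\<close>, its poles are the points
  where this exponential is \<open>- 1\<close>.\<close>

definition scaled_tanh :: "real \<Rightarrow> complex \<Rightarrow> complex" where
  "scaled_tanh s u =
     (if s = 0 then u
      else (exp (2 * of_real s * u) - 1) / (of_real s * (exp (2 * of_real s * u) + 1)))"

lemma scaled_artanh_0 [simp]: "scaled_artanh s 0 = 0"
  by (simp add: scaled_artanh_def)

lemma scaled_tanh_0 [simp]: "scaled_tanh s 0 = 0"
  by (simp add: scaled_tanh_def)

lemma Re_one_plus_pos:
  fixes u :: complex
  assumes "norm u < 1"
  shows "0 < Re (1 + u)" "0 < Re (1 - u)"
  using abs_Re_le_cmod[of u] assms by auto

lemma norm_scaled_less_one: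
  fixes z :: complex
  assumes "0 \<le> s" "s < 1" "norm z < 1"
  shows "norm (of_real s * z) < 1" "norm ((of_real s)\<^sup>2 * z\<^sup>2) < 1"
proof -
  show 1: "norm (of_real s * z) < 1"
    using assms by (simp add: norm_mult mult_strict_mono' le_less_trans[OF mult_right_le_one_le])
  have "norm ((of_real s)\<^sup>2 * z\<^sup>2) = (norm (of_real s * z))\<^sup>2"
    by (simp add: norm_mult norm_power power_mult_distrib)
  then show "norm ((of_real s)\<^sup>2 * z\<^sup>2) < 1"
    using 1 by (simp add: power_less_one_iff)
qed

lemma one_minus_scaled_square_nonzero:
  fixes z :: complex
  assumes "0 \<le> s" "s < 1" "norm z < 1"
  shows "1 - (of_real s)\<^sup>2 * z\<^sup>2 \<noteq> 0"
  using norm_scaled_less_one(2)[OF assms] by auto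

lemma has_field_derivative_scaled_artanh:
  assumes "0 \<le> s" "s < 1" "norm z < 1"
  shows "(scaled_artanh s has_field_derivative 1 / (1 - (of_real s)\<^sup>2 * z\<^sup>2)) (at z)"
proof (cases "s = 0")
  case True
  then have "scaled_artanh s = (\<lambda>z. z)"
    by (auto simp: scaled_artanh_def)
  with True show ?thesis by simp
next
  case False
  let ?s = "of_real s :: complex"
  have pos: "0 < Re (1 + ?s * z)" "0 < Re (1 - ?s * z)"
    by (intro Re_one_plus_pos norm_scaled_less_one assms)+
  then have nz: "1 + ?s * z \<noteq> 0" "1 - ?s * z \<noteq> 0" by force+
  have dom: "1 + ?s * z \<notin> \<real>\<^sub>\<le>\<^sub>0" "1 - ?s * z \<notin> \<real>\<^sub>\<le>\<^sub>0"
    using pos by (auto simp: complex_nonpos_Reals_iff)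
  have eq: "scaled_artanh s = (\<lambda>z. (Ln (1 + ?s * z) - Ln (1 - ?s * z)) / (2 * ?s))"
    using False by (auto simp: scaled_artanh_def)
  have fac: "1 - ?s\<^sup>2 * z\<^sup>2 = (1 + ?s * z) * (1 - ?s * z)"
    by (simp add: algebra_simps power2_eq_square)
  show ?thesis
    unfolding eq fac using False nz dom
    by (auto intro!: derivative_eq_intros simp: divide_simps) (auto simp: algebra_simps)
qed

text \<open>The Riccati equation \<open>T' = 1 - s\<^sup>2 T\<^sup>2\<close> turns a logarithm \<open>p\<close> into \<open>T \<circ> p\<close> without any choice
  of branches. The bound on \<open>u\<close> excludes the poles, the nearest of which lie at
  \<open>2 s u = \<plusminus> \<i> \<pi>\<close>.\<close>

lemma has_field_derivative_scaled_tanh: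
  assumes "norm (2 * of_real s * u) < pi"
  shows "(scaled_tanh s has_field_derivative 1 - (of_real s)\<^sup>2 * (scaled_tanh s u)\<^sup>2) (at u)"
proof (cases "s = 0")
  case True
  then have "scaled_tanh s = (\<lambda>u. u)"
    by (auto simp: scaled_tanh_def)
  with True show ?thesis by simp
next
  case False
  let ?s = "of_real s :: complex" and ?E = "exp (2 * of_real s * u)"
  have nz: "?E + 1 \<noteq> 0"
  proof
    assume "?E + 1 = 0"
    then have "exp (2 * ?s * u) = exp (of_real pi * \<i>)"
      by (simp add: add_eq_0_iff2)
    then obtain n :: int where "2 * ?s * u = of_real pi * \<i> + (of_int (2 * n) * pi) * \<i>"
      unfolding exp_eq by auto
    then have "Im (2 * ?s * u) = of_int (2 * n + 1) * pi"
      by (simp add: algebra_simps)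
    then have "\<bar>of_int (2 * n + 1)\<bar> * pi = \<bar>Im (2 * ?s * u)\<bar>"
      by (simp only: abs_mult) simp
    also have "\<dots> \<le> norm (2 * ?s * u)"
      by (rule abs_Im_le_cmod)
    also note assms
    finally have "\<bar>of_int (2 * n + 1)\<bar> * pi < pi" .
    then have "\<bar>of_int (2 * n + 1) :: real\<bar> < 1"
      using mult_less_cancel_right_pos[OF pi_gt_zero, of "\<bar>of_int (2 * n + 1)\<bar>" 1] by simp
    then have "\<bar>2 * n + 1\<bar> < 1" by linarith
    then show False by presburger
  qed
  have eq: "scaled_tanh s = (\<lambda>u. (exp (2 * ?s * u) - 1) / (?s * (exp (2 * ?s * u) + 1)))"
    using False by (auto simp: scaled_tanh_def)
  show ?thesis
    unfolding eq using False nz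
    by (auto intro!: derivative_eq_intros simp: divide_simps)
       (auto simp: algebra_simps power2_eq_square)
qed

text \<open>Reality on the real axis fixes the argument of \<open>z G'(z)\<close> for \<open>G = exp \<circ> scaled_artanh s\<close>
  at the two ends of a half circle, and it identifies the values of \<open>G\<close> there with the bounds
  of the theorem.\<close>

lemma scaled_artanh_of_real:
  assumes "0 \<le> s" "s < 1" "\<bar>x\<bar> < 1"
  shows "Im (scaled_artanh s (of_real x)) = 0"
    and "exp (scaled_artanh s (of_real x)) = of_real (BS_upper (s\<^sup>2) x)"
proof -
  have "norm (of_real s * complex_of_real x) < 1"
    by (intro norm_scaled_less_one) (use assms in auto)
  then have sx: "\<bar>s * x\<bar> < 1" by (simp add: norm_mult abs_mult)
  have ln: "Ln (1 + of_real s * of_real x) = of_real (ln (1 + s * x))"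
       "Ln (1 - of_real s * of_real x) = of_real (ln (1 - s * x))"
    using sx Ln_of_real[of "1 + s * x"] Ln_of_real[of "1 - s * x"] by auto
  have val: "scaled_artanh s (of_real x) =
      of_real (if s = 0 then x else (ln (1 + s * x) - ln (1 - s * x)) / (2 * s))"
    by (simp add: scaled_artanh_def ln)
  then show "Im (scaled_artanh s (of_real x)) = 0" by simp
  have "BS_upper (s\<^sup>2) x = exp (if s = 0 then x else (ln (1 + s * x) - ln (1 - s * x)) / (2 * s))"
    using sx assms by (auto simp: BS_upper_def powr_def ln_div mult.commute)
  then show "exp (scaled_artanh s (of_real x)) = of_real (BS_upper (s\<^sup>2) x)"
    unfolding val by (simp add: exp_of_real)
qed

text \<open>Reading the lower bound as the upper one at \<open>- r\<close> lets both be treated as values of one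
  increasing function.\<close>

lemma BS_lower_eq_upper: "BS_lower \<alpha> r = BS_upper \<alpha> (- r)"
  by (simp add: BS_lower_def BS_upper_def)

lemma BS_upper_mono:
  assumes "0 \<le> s" "s < 1" "\<bar>x\<bar> < 1" "\<bar>y\<bar> < 1" "x \<le> y"
  shows "BS_upper (s\<^sup>2) x \<le> BS_upper (s\<^sup>2) y"
proof (cases "s = 0")
  case True
  with assms show ?thesis by (simp add: BS_upper_def)
next
  case False
  have "\<bar>s * x\<bar> < 1" "\<bar>s * y\<bar> < 1"
    using norm_scaled_less_one(1)[of s "of_real x"] norm_scaled_less_one(1)[of s "of_real y"] assms
    by (auto simp: norm_mult abs_mult)
  moreover have "s * x \<le> s * y"
    using assms by (simp add: mult_left_mono)
  ultimately have "(1 + x * s) / (1 - x * s) \<le> (1 + y * s) / (1 - y * s)" "0 < (1 + x * s) / (1 - x * s)"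
    by (auto intro!: frac_le simp: mult.commute)
  then show ?thesis
    using assms False by (auto simp: BS_upper_def intro!: powr_mono2)
qed

section \<open>Differentiation along curves and Jack's lemma\<close>

lemma holomorphic_on_ball_if_deriv:
  assumes "\<And>z. norm z < 1 \<Longrightarrow> (f has_field_derivative f' z) (at z)"
  shows "f holomorphic_on ball 0 1"
  unfolding holomorphic_on_open[OF open_ball] using assms by (auto intro!: exI)

lemma has_real_derivative_Re_comp:
  assumes "(H has_field_derivative H') (at (\<gamma> t))" "(\<gamma> has_vector_derivative \<gamma>') (at t)"
  shows "((\<lambda>t. Re (H (\<gamma> t))) has_real_derivative Re (\<gamma>' * H')) (at t)"
proof -
  have "((H \<circ> \<gamma>) has_vector_derivative \<gamma>' * H') (at t)"
    by (rule field_vector_diff_chain_at) (use assms in auto)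
  then show ?thesis
    unfolding has_real_derivative_iff_has_vector_derivative o_def
    by (rule bounded_linear.has_vector_derivative[OF bounded_linear_Re])
qed

lemma has_vector_derivative_circle:
  "((\<lambda>t. z * exp (\<i> * of_real t)) has_vector_derivative \<i> * (z * exp (\<i> * of_real t))) (at t)"
  by (rule has_vector_derivative_real_field)
     (auto intro!: derivative_eq_intros)

text \<open>At the point \<open>z0\<close>, where \<open>\<bar>\<omega>\<bar>\<close> is maximal over the disc \<open>\<bar>z\<bar> \<le> \<bar>z0\<bar>\<close>, the logarithmic derivative
  \<open>L = z0 \<omega>'(z0) / \<omega>(z0)\<close> is read off from two curves through \<open>z0\<close>. Along the radius, Schwarz'
  lemma gives \<open>\<bar>\<omega> (t z0)\<bar> \<le> t\<close> with equality at \<open>t = 1\<close>, so \<open>Re L \<ge> 1\<close>. Along the circle, \<open>\<bar>\<omega>\<bar>\<close> has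
  a maximum at \<open>z0\<close>, so \<open>Im L = 0\<close>. The modulus is replaced by the real part of
  \<open>H = cnj (\<omega> z0) * \<omega>\<close>, which is differentiable, lies below it, and agrees with it at \<open>z0\<close>.\<close>

lemma Jack_lemma:
  assumes hol: "\<omega> holomorphic_on ball 0 1" and "\<omega> 0 = 0"
    and z0: "norm z0 < 1" and val: "norm (\<omega> z0) = 1"
    and inside: "\<And>z. norm z < norm z0 \<Longrightarrow> norm (\<omega> z) < 1"
  obtains m :: real where "1 \<le> m" "z0 * deriv \<omega> z0 = of_real m * \<omega> z0"
proof -
  let ?\<rho> = "norm z0"
  define \<zeta> where "\<zeta> = \<omega> z0"
  define H where "H z = cnj \<zeta> * \<omega> z" for z
  have \<rho>: "0 < ?\<rho>" using val \<open>\<omega> 0 = 0\<close> by auto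
  have \<zeta>1: "cnj \<zeta> * \<zeta> = 1" "norm \<zeta> = 1"
    using val complex_norm_square[of "\<omega> z0"] by (auto simp: \<zeta>_def mult.commute)
  have H0: "H z0 = 1" using \<zeta>1 by (simp add: H_def \<zeta>_def)
  have ReH: "Re (H z) \<le> norm (\<omega> z)" for z
    using complex_Re_le_cmod[of "H z"] \<zeta>1 by (simp add: H_def norm_mult)
  have "(\<omega> has_field_derivative deriv \<omega> z0) (at z0)"
    by (rule holomorphic_derivI[OF hol]) (use z0 in auto)
  then have dH: "(H has_field_derivative cnj \<zeta> * deriv \<omega> z0) (at z0)"
    unfolding H_def by (rule DERIV_cmult)
  have schwarz: "norm (\<omega> (of_real t * z0)) \<le> t" if "0 < t" "t < 1" for t
  proof -
    have "norm ((\<lambda>z. \<omega> (z * z0)) (of_real t)) \<le> norm (complex_of_real t)"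
    proof (rule Schwarz_Lemma(1))
      have sub: "(\<lambda>z. z * z0) ` ball 0 1 \<subseteq> ball 0 1"
        using z0 by (auto simp: norm_mult intro!: le_less_trans[OF mult_left_le_one_le])
      show "(\<lambda>z. \<omega> (z * z0)) holomorphic_on ball 0 1"
        using holomorphic_on_compose_gen[OF _ hol sub] by (simp add: o_def holomorphic_intros)
      show "norm (\<omega> (z * z0)) < 1" if "norm z < 1" for z
        by (rule inside) (use that \<rho> in \<open>simp add: norm_mult\<close>)
    qed (use that \<open>\<omega> 0 = 0\<close> in auto)
    then show ?thesis using that by simp
  qed
  define L where "L = z0 * (cnj \<zeta> * deriv \<omega> z0)"
  have "1 \<le> Re L"
  proof (rule ccontr)
    assume "\<not> 1 \<le> Re L"
    have "((\<lambda>t. of_real t * z0) has_vector_derivative z0) (at 1)"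
      by (rule has_vector_derivative_real_field) (auto intro!: derivative_eq_intros)
    then have "((\<lambda>t. Re (H (of_real t * z0))) has_real_derivative Re L) (at 1)"
      unfolding L_def by (intro has_real_derivative_Re_comp) (use dH in simp_all)
    from DERIV_diff[OF DERIV_ident this]
    have "((\<lambda>t. t - Re (H (of_real t * z0))) has_real_derivative 1 - Re L) (at 1)" .
    then obtain d where "d > 0" and
      d: "\<And>h. 0 < h \<Longrightarrow> h < d \<Longrightarrow> (1 - h) - Re (H (of_real (1 - h) * z0)) < 1 - Re (H (of_real 1 * z0))"
      using DERIV_pos_inc_left[of "\<lambda>t. t - Re (H (of_real t * z0))" "1 - Re L" 1] \<open>\<not> 1 \<le> Re L\<close>
      by auto
    define h where "h = min (d / 2) (1 / 2)"
    have h: "0 < h" "h < d" "h < 1" using \<open>d > 0\<close> by (auto simp: h_def)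
    show False
      using d[OF h(1,2)] schwarz[of "1 - h"] ReH[of "of_real (1 - h) * z0"] h H0 by simp
  qed
  moreover have "Im L = 0"
  proof -
    have le1: "norm (\<omega> z) \<le> 1" if "norm z = ?\<rho>" for z
    proof (rule continuous_on_closure_norm_le[of "ball 0 ?\<rho>" \<omega>])
      show "continuous_on (closure (ball 0 ?\<rho>)) \<omega>"
        by (rule holomorphic_on_imp_continuous_on, rule holomorphic_on_subset[OF hol])
           (use \<rho> z0 in auto)
    qed (use \<rho> inside that in \<open>auto simp: less_imp_le\<close>)
    have "((\<lambda>t. Re (H (z0 * exp (\<i> * of_real t)))) has_real_derivative
        Re (\<i> * (z0 * exp (\<i> * of_real 0)) * (cnj \<zeta> * deriv \<omega> z0))) (at 0)"
      by (rule has_real_derivative_Re_comp) (use dH in simp, rule has_vector_derivative_circle)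
    then have "Re (\<i> * (z0 * exp (\<i> * of_real 0)) * (cnj \<zeta> * deriv \<omega> z0)) = 0"
    proof (rule DERIV_local_max[where d = 1])
      show "\<forall>y. \<bar>0 - y\<bar> < 1 \<longrightarrow> Re (H (z0 * exp (\<i> * of_real y))) \<le> Re (H (z0 * exp (\<i> * of_real 0)))"
        using order_trans[OF ReH le1] by (simp add: H0 norm_mult)
    qed simp
    then show ?thesis by (simp add: L_def algebra_simps)
  qed
  ultimately have L: "of_real (Re L) = L" "1 \<le> Re L" by (auto simp: complex_eq_iff)
  have "of_real (Re L) * \<zeta> = (cnj \<zeta> * \<zeta>) * (z0 * deriv \<omega> z0)"
    unfolding L(1) by (simp add: L_def)
  then have "z0 * deriv \<omega> z0 = of_real (Re L) * \<omega> z0"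
    unfolding \<zeta>1 by (simp add: \<zeta>_def)
  with L(2) show ?thesis
    by (rule that)
qed

section \<open>Subordination for the logarithm\<close>

text \<open>The equation \<open>F w = m F \<zeta>\<close> for the kernel \<open>F z = z / (1 - a z\<^sup>2)\<close>, cleared of denominators.
  It has no solution because \<open>1 / F\<close> maps circles about 0 to ellipses: with \<open>\<rho> = \<bar>w\<bar>\<close> the
  semi-axes \<open>1/\<rho> - a \<rho>\<close> and \<open>1/\<rho> + a \<rho>\<close> both exceed the values \<open>1 - a\<close> and \<open>1 + a\<close> for the
  unit circle, so \<open>1 / F w\<close> lies strictly outside the ellipse filled by the points
  \<open>1 / (m F \<zeta>)\<close>. In the proof this appears coordinatewise: each nonzero coordinate of \<open>w\<close> is in
  absolute value strictly smaller than \<open>\<rho>\<close> times that of \<open>\<zeta>\<close>, which is incompatible with \<open>\<bar>w\<bar> = \<rho> \<bar>\<zeta>\<bar>\<close>.\<close>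

lemma kernel_starlike:
  fixes w \<zeta> :: complex and a m :: real
  assumes a: "0 \<le> a" "a < 1" and w: "norm w < 1" and \<zeta>: "norm \<zeta> = 1" and m: "1 \<le> m"
  shows "w * (1 - of_real a * \<zeta>\<^sup>2) \<noteq> of_real m * \<zeta> * (1 - of_real a * w\<^sup>2)"
proof
  assume eq: "w * (1 - of_real a * \<zeta>\<^sup>2) = of_real m * \<zeta> * (1 - of_real a * w\<^sup>2)"
  define \<rho> where "\<rho> = norm w"
  have ww: "w * cnj w = of_real (\<rho>\<^sup>2)" and \<zeta>\<zeta>: "\<zeta> * cnj \<zeta> = 1"
    using \<zeta> complex_norm_square[of w] complex_norm_square[of \<zeta>] by (simp_all add: \<rho>_def)
  \<comment> \<open>Multiplying by \<open>cnj w * cnj \<zeta>\<close> makes both sides real-linear in the coordinates of \<open>\<zeta>\<close> and \<open>w\<close>.\<close>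
  have "w * (1 - of_real a * \<zeta>\<^sup>2) * (cnj w * cnj \<zeta>) = (w * cnj w) * (cnj \<zeta> - of_real a * \<zeta> * (\<zeta> * cnj \<zeta>))"
    "of_real m * \<zeta> * (1 - of_real a * w\<^sup>2) * (cnj w * cnj \<zeta>)
      = of_real m * (\<zeta> * cnj \<zeta>) * (cnj w - of_real a * w * (w * cnj w))"
    by (simp_all add: algebra_simps power2_eq_square)
  then have "of_real (\<rho>\<^sup>2) * (cnj \<zeta> - of_real a * \<zeta>) = of_real m * (cnj w - of_real a * w * of_real (\<rho>\<^sup>2))"
    using eq unfolding ww \<zeta>\<zeta> by simp
  then have re: "\<rho>\<^sup>2 * (1 - a) * Re \<zeta> = m * (1 - a * \<rho>\<^sup>2) * Re w"
    and im: "\<rho>\<^sup>2 * (1 + a) * Im \<zeta> = m * (1 + a * \<rho>\<^sup>2) * Im w"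
    by (auto simp: complex_eq_iff algebra_simps)
  have "w \<noteq> 0"
    using eq \<zeta> m by auto
  then have \<rho>: "0 < \<rho>" "\<rho> < 1" using w by (auto simp: \<rho>_def)
  have pyth: "(Re w)\<^sup>2 + (Im w)\<^sup>2 = \<rho>\<^sup>2" "(Re \<zeta>)\<^sup>2 + (Im \<zeta>)\<^sup>2 = 1"
    using \<zeta> cmod_power2[of \<zeta>] cmod_power2[of w] by (auto simp: \<rho>_def)
  have shrink: "u = 0 \<or> \<bar>u\<bar> < \<rho> * \<bar>x\<bar>"
    if "\<rho>\<^sup>2 * k * x = m * l * u" "\<rho> * k < l" "0 < k" for u x k l :: real
  proof (cases "u = 0")
    case False
    have l: "0 < l" using that \<rho> by (meson mult_pos_pos less_trans)
    have "l * \<bar>u\<bar> \<le> m * l * \<bar>u\<bar>" using m l by (simp add: mult_le_cancel_right1)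
    also have "\<dots> = \<rho>\<^sup>2 * k * \<bar>x\<bar>"
    proof -
      have "\<bar>m * l * u\<bar> = \<bar>\<rho>\<^sup>2 * k * x\<bar>" by (simp only: that(1))
      then show ?thesis unfolding abs_mult using m l that(3) by simp
    qed
    also have "\<dots> = (\<rho> * k) * (\<rho> * \<bar>x\<bar>)" by (simp add: power2_eq_square)
    also have "\<dots> < l * (\<rho> * \<bar>x\<bar>)"
    proof (rule mult_strict_right_mono)
      have "x \<noteq> 0" using that(1) False m l by auto
      then show "0 < \<rho> * \<bar>x\<bar>" using \<rho> by simp
    qed (fact that)
    finally show ?thesis using l by simp
  qed simp
  \<comment> \<open>These products are the gaps \<open>(1 - a \<rho>\<^sup>2) - \<rho> (1 - a)\<close> and \<open>(1 + a \<rho>\<^sup>2) - \<rho> (1 + a)\<close>.\<close>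
  have "0 < (1 - \<rho>) * (1 + a * \<rho>)" "0 < (1 - \<rho>) * (1 - a * \<rho>)"
    using a \<rho> by (auto intro!: mult_pos_pos add_pos_nonneg simp: mult_le_one
        le_less_trans[OF mult_left_le_one_le[of \<rho> a]])
  then have "\<rho> * (1 - a) < 1 - a * \<rho>\<^sup>2" "\<rho> * (1 + a) < 1 + a * \<rho>\<^sup>2"
    by (auto simp: algebra_simps power2_eq_square)
  then have "Re w = 0 \<or> \<bar>Re w\<bar> < \<rho> * \<bar>Re \<zeta>\<bar>" "Im w = 0 \<or> \<bar>Im w\<bar> < \<rho> * \<bar>Im \<zeta>\<bar>"
    using shrink[OF re] shrink[OF im] a by auto
  moreover have "x\<^sup>2 < (\<rho> * y)\<^sup>2" if "\<bar>x\<bar> < \<rho> * \<bar>y\<bar>" for x y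
    using power_strict_mono[OF that, of 2] \<rho> by (simp add: power_mult_distrib)
  ultimately have *: "(Re w)\<^sup>2 \<le> (\<rho> * Re \<zeta>)\<^sup>2" "(Im w)\<^sup>2 \<le> (\<rho> * Im \<zeta>)\<^sup>2"
    "(Re w)\<^sup>2 < (\<rho> * Re \<zeta>)\<^sup>2 \<or> (Im w)\<^sup>2 < (\<rho> * Im \<zeta>)\<^sup>2"
    using \<open>w \<noteq> 0\<close> by (auto simp: less_imp_le complex_eq_iff)
  then have "(Re w)\<^sup>2 + (Im w)\<^sup>2 < (\<rho> * Re \<zeta>)\<^sup>2 + (\<rho> * Im \<zeta>)\<^sup>2" by linarith
  also have "\<dots> = \<rho>\<^sup>2"
    using pyth(2) by (simp add: power_mult_distrib flip: distrib_left)
  finally show False using pyth(1) by simp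
qed

text \<open>The solution of \<open>z p'(z) = F (w z)\<close> is subordinate to the solution \<open>q\<close> of \<open>z q'(z) = F z\<close>. The
  function \<open>\<omega> = scaled_tanh s \<circ> p\<close> satisfies \<open>\<omega>' = (1 - s\<^sup>2 \<omega>\<^sup>2) p'\<close>, that is
  \<open>z \<omega>' / \<omega> = F (w z) / F (\<omega> z)\<close> off the zeros of \<open>\<omega>\<close>, and Jack's lemma together with \<open>kernel_starlike\<close> prevents it from
  reaching the unit circle. Inside the disc \<open>q \<circ> \<omega>\<close> and \<open>p\<close> have the same derivative.\<close>

lemma subordinate_scaled_artanh:
  assumes s: "0 \<le> s" "s < 1"
    and p: "p holomorphic_on ball 0 1" "p 0 = 0"
    and w: "\<And>z. norm z < 1 \<Longrightarrow> norm (w z) < 1"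
    and ode: "\<And>z. norm z < 1 \<Longrightarrow> z * deriv p z = w z / (1 - (of_real s)\<^sup>2 * (w z)\<^sup>2)"
    and small: "\<And>z. norm z < 1 \<Longrightarrow> norm (2 * of_real s * p z) < pi"
  obtains \<omega> where "\<And>z. norm z < 1 \<Longrightarrow> norm (\<omega> z) \<le> norm z"
    "\<And>z. norm z < 1 \<Longrightarrow> p z = scaled_artanh s (\<omega> z)"
proof -
  let ?S = "(of_real s :: complex)\<^sup>2"
  define \<omega> where "\<omega> z = scaled_tanh s (p z)" for z
  have \<omega>0: "\<omega> 0 = 0" by (simp add: \<omega>_def p)
  have d\<omega>: "(\<omega> has_field_derivative (1 - ?S * (\<omega> z)\<^sup>2) * deriv p z) (at z)" if "norm z < 1" for z
    unfolding \<omega>_def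
    by (rule DERIV_chain2[OF has_field_derivative_scaled_tanh holomorphic_derivI[OF p(1)]])
       (use that small in auto)
  have hol: "\<omega> holomorphic_on ball 0 1"
    by (rule holomorphic_on_ball_if_deriv) (rule d\<omega>)
  have lt1: "norm (\<omega> z) < 1" if z: "norm z < 1" for z
  proof (rule ccontr)
    assume "\<not> norm (\<omega> z) < 1"
    \<comment> \<open>A point of least modulus in \<open>K\<close> is a first point at which \<open>\<omega>\<close> meets the unit circle.\<close>
    define K where "K = {x \<in> cball 0 (norm z). 1 \<le> norm (\<omega> x)}"
    have cont: "continuous_on (cball 0 (norm z)) \<omega>"
      by (rule holomorphic_on_imp_continuous_on, rule holomorphic_on_subset[OF hol]) (use z in auto)
    have "closed K"
      unfolding K_def by (rule continuous_on_closed_Collect_le) (auto intro!: continuous_intros cont)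
    then have "compact K"
      by (simp add: K_def compact_eq_bounded_closed bounded_subset[OF bounded_cball[of 0 "norm z"]] subset_iff)
    moreover have "z \<in> K" using \<open>\<not> norm (\<omega> z) < 1\<close> by (simp add: K_def)
    ultimately obtain z0 where z0: "z0 \<in> K" and min: "\<And>x. x \<in> K \<Longrightarrow> norm z0 \<le> norm x"
      using continuous_attains_inf[of K norm] by (auto intro: continuous_intros)
    have z0': "norm z0 \<le> norm z" "1 \<le> norm (\<omega> z0)" using z0 by (auto simp: K_def)
    have inside: "norm (\<omega> x) < 1" if "norm x < norm z0" for x
      using min[of x] that z0' by (force simp: K_def)
    have "z0 \<noteq> 0" using z0' \<omega>0 by auto
    have "norm (\<omega> z0) \<le> 1"
    proof (rule continuous_on_closure_norm_le[of "ball 0 (norm z0)" \<omega>])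
      show "continuous_on (closure (ball 0 (norm z0))) \<omega>"
        by (rule continuous_on_subset[OF cont]) (use z0' \<open>z0 \<noteq> 0\<close> in auto)
    qed (use \<open>z0 \<noteq> 0\<close> inside in \<open>auto simp: less_imp_le\<close>)
    then have val: "norm (\<omega> z0) = 1" using z0' by simp
    have n0: "norm z0 < 1" using z z0' by simp
    obtain m where m: "1 \<le> m" "z0 * deriv \<omega> z0 = of_real m * \<omega> z0"
      by (rule Jack_lemma[OF hol \<omega>0 n0 val inside])
    have "of_real m * \<omega> z0 = (1 - ?S * (\<omega> z0)\<^sup>2) * (z0 * deriv p z0)"
      using m(2) DERIV_imp_deriv[OF d\<omega>[OF n0]] by (simp add: mult.left_commute)
    also have "\<dots> = (1 - ?S * (\<omega> z0)\<^sup>2) * (w z0 / (1 - ?S * (w z0)\<^sup>2))"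
      using ode[OF n0] by simp
    finally have "w z0 * (1 - of_real (s\<^sup>2) * (\<omega> z0)\<^sup>2) = of_real m * \<omega> z0 * (1 - of_real (s\<^sup>2) * (w z0)\<^sup>2)"
      using one_minus_scaled_square_nonzero[OF s w[OF n0]] by (simp add: field_simps)
    then show False
      using kernel_starlike[of "s\<^sup>2" "w z0" "\<omega> z0" m] s w[OF n0] val m by (simp add: power_less_one_iff)
  qed
  have "(\<lambda>z. scaled_artanh s (\<omega> z) - p z) constant_on ball 0 1"
  proof (rule has_field_derivative_0_imp_constant_on)
    fix z :: complex assume "z \<in> ball 0 1"
    then have z: "norm z < 1" by simp
    have "((\<lambda>z. scaled_artanh s (\<omega> z) - p z) has_field_derivative
        1 / (1 - ?S * (\<omega> z)\<^sup>2) * ((1 - ?S * (\<omega> z)\<^sup>2) * deriv p z) - deriv p z) (at z)"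
      by (intro derivative_intros DERIV_chain2[OF has_field_derivative_scaled_artanh d\<omega>]
          holomorphic_derivI[OF p(1)]) (use s z lt1 in auto)
    then show "((\<lambda>z. scaled_artanh s (\<omega> z) - p z) has_field_derivative 0) (at z)"
      using one_minus_scaled_square_nonzero[OF s lt1[OF z]] by simp
  qed auto
  then obtain c where c: "\<And>z. norm z < 1 \<Longrightarrow> scaled_artanh s (\<omega> z) - p z = c"
    by (auto simp: constant_on_def)
  have "c = 0" using c[of 0] p \<omega>0 by simp
  show ?thesis
  proof (rule that[of \<omega>])
    show "norm (\<omega> z) \<le> norm z" if "norm z < 1" for z
      by (rule Schwarz_Lemma(1)[OF hol \<omega>0 lt1 that])
    show "p z = scaled_artanh s (\<omega> z)" if "norm z < 1" for z
      using c[OF that] \<open>c = 0\<close> by simp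
  qed
qed

section \<open>The class and its logarithms\<close>

lemma norm_kernel_le:
  fixes u :: complex
  assumes s: "0 \<le> s" "s < 1" and u: "norm u < 1"
  shows "norm (1 / (1 - (of_real s)\<^sup>2 * u\<^sup>2)) \<le> 1 / (1 - s\<^sup>2)"
proof -
  have "norm ((of_real s)\<^sup>2 * u\<^sup>2) \<le> s\<^sup>2 * 1"
    unfolding norm_mult using u
    by (intro mult_mono) (auto simp: norm_power power_le_one)
  then have "1 - s\<^sup>2 \<le> norm (1 - (of_real s)\<^sup>2 * u\<^sup>2)"
    using norm_triangle_ineq2[of 1 "(of_real s)\<^sup>2 * u\<^sup>2"] by simp
  moreover have "0 < 1 - s\<^sup>2" using s by (simp add: power_less_one_iff)
  ultimately show ?thesis by (simp add: norm_divide frac_le)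
qed

text \<open>The logarithm of \<open>f z / z\<close> is constructed as a primitive of \<open>F (w z) / z\<close>, where the removable
  singularity is divided out through \<open>w z = z k z\<close>. As \<open>\<bar>k\<bar> \<le> 1\<close> by Schwarz' lemma, the integrand is
  bounded by \<open>1 / (1 - s\<^sup>2)\<close>, which gives the linear bound on \<open>p\<close>.\<close>

lemma BS_logarithm:
  assumes f: "f \<in> BS (s\<^sup>2)" and s: "0 \<le> s" "s < 1"
  obtains p w where "p holomorphic_on ball 0 1" "p 0 = 0"
    "\<And>z. norm z < 1 \<Longrightarrow> norm (w z) < 1"
    "\<And>z. norm z < 1 \<Longrightarrow> z * deriv p z = w z / (1 - (of_real s)\<^sup>2 * (w z)\<^sup>2)"
    "\<And>z. norm z < 1 \<Longrightarrow> norm (p z) \<le> norm z / (1 - s\<^sup>2)"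
    "\<And>z. norm z < 1 \<Longrightarrow> quot_id f z = exp (p z)"
proof -
  let ?S = "(of_real s :: complex)\<^sup>2"
  have hf: "f holomorphic_on ball 0 1" "f 0 = 0" "deriv f 0 = 1"
    and nz: "\<And>z. norm z < 1 \<Longrightarrow> z \<noteq> 0 \<Longrightarrow> f z \<noteq> 0"
    using f by (auto simp: BS_def class_A_def)
  obtain w where w: "w holomorphic_on ball 0 1" "w 0 = 0" "\<And>z. norm z < 1 \<Longrightarrow> norm (w z) < 1"
    and fw: "\<And>z. norm z < 1 \<Longrightarrow> log_deriv_quot f z - 1 = w z / (1 - ?S * (w z)\<^sup>2)"
    using f by (auto simp: BS_def subordinate_def)
  obtain k where k: "k holomorphic_on ball 0 1" "\<And>z. norm z < 1 \<Longrightarrow> w z = z * k z" "deriv w 0 = k 0"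
    using Schwarz3[OF w(1,2)] by blast
  have k1: "norm (k z) \<le> 1" if z: "norm z < 1" for z
  proof (cases "z = 0")
    case True
    then show ?thesis using Schwarz_Lemma(2)[OF w(1,2,3) z] k(3) by simp
  next
    case False
    then show ?thesis
      using Schwarz_Lemma(1)[OF w(1,2,3) z] k(2)[OF z] by (simp add: norm_mult)
  qed
  have den: "1 - ?S * (w z)\<^sup>2 \<noteq> 0" if "norm z < 1" for z
    by (rule one_minus_scaled_square_nonzero[OF s w(3)[OF that]])
  have "(\<lambda>z. k z / (1 - ?S * (w z)\<^sup>2)) holomorphic_on ball 0 1"
    using den by (intro holomorphic_intros k w) auto
  then obtain P where P: "\<And>z. z \<in> ball 0 1 \<Longrightarrow> (P has_field_derivative k z / (1 - ?S * (w z)\<^sup>2)) (at z within ball 0 1)"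
    using holomorphic_convex_primitive'[OF convex_ball open_ball] by blast
  define p where "p z = P z - P 0" for z
  have dp: "(p has_field_derivative k z / (1 - ?S * (w z)\<^sup>2)) (at z)" if "norm z < 1" for z
  proof -
    have "(P has_field_derivative k z / (1 - ?S * (w z)\<^sup>2)) (at z)"
    proof -
      have "z \<in> ball 0 1" using that by simp
      from P[OF this] show ?thesis unfolding at_within_open[OF \<open>z \<in> ball 0 1\<close> open_ball] .
    qed
    from DERIV_diff[OF this DERIV_const[of "P 0"]] show ?thesis
      by (simp add: p_def[abs_def])
  qed
  have hp: "p holomorphic_on ball 0 1"
    by (rule holomorphic_on_ball_if_deriv) (rule dp)
  have ode: "z * deriv p z = w z / (1 - ?S * (w z)\<^sup>2)" if "norm z < 1" for z
    using DERIV_imp_deriv[OF dp[OF that]] k(2)[OF that] by simp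
  have bound: "norm (p z) \<le> norm z / (1 - s\<^sup>2)" if z: "norm z < 1" for z
  proof -
    have "norm (p z - p 0) \<le> 1 / (1 - s\<^sup>2) * norm (z - 0)"
    proof (rule field_differentiable_bound[OF convex_ball[of 0 1]])
      show "norm (k x / (1 - ?S * (w x)\<^sup>2)) \<le> 1 / (1 - s\<^sup>2)" if "x \<in> ball 0 1" for x
      proof -
        have "norm (k x) * norm (1 / (1 - ?S * (w x)\<^sup>2)) \<le> 1 * (1 / (1 - s\<^sup>2))"
          using that by (intro mult_mono k1 norm_kernel_le s w) auto
        then show ?thesis by (simp add: norm_divide)
      qed
    qed (use z dp in \<open>auto intro: has_field_derivative_at_within\<close>)
    then show ?thesis by (simp add: p_def)
  qed
  obtain g where g: "g holomorphic_on ball 0 1" "\<And>z. norm z < 1 \<Longrightarrow> f z = z * g z" "deriv f 0 = g 0"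
    using Schwarz3[OF hf(1,2)] by blast
  have gq: "quot_id f z = g z" if "norm z < 1" for z
    using g(2)[OF that] g(3) hf(3) by (simp add: quot_id_def)
  have "(\<lambda>z. g z * exp (- p z)) constant_on ball 0 1"
  proof (rule DERIV_zero_connected_constant_on[where K = "{0}"])
    show "continuous_on (ball 0 1) (\<lambda>z. g z * exp (- p z))"
      by (intro holomorphic_on_imp_continuous_on holomorphic_intros g hp)
    show "\<forall>z\<in>ball 0 1 - {0}. ((\<lambda>z. g z * exp (- p z)) has_field_derivative 0) (at z)"
    proof
      fix z :: complex assume "z \<in> ball 0 1 - {0}"
      then have z: "norm z < 1" "z \<noteq> 0" by auto
      have dg: "(g has_field_derivative deriv g z) (at z)"
        by (rule holomorphic_derivI[OF g(1)]) (use z in auto)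
      have dp': "(p has_field_derivative deriv p z) (at z)"
        by (rule holomorphic_derivI[OF hp]) (use z in auto)
      have "((\<lambda>z. z * g z) has_field_derivative g z + z * deriv g z) (at z)"
        by (auto intro!: derivative_eq_intros dg)
      moreover have "eventually (\<lambda>z. f z = z * g z) (nhds z)"
        using g(2) z by (auto simp: eventually_nhds intro!: exI[of _ "ball 0 1"])
      ultimately have df: "deriv f z = g z + z * deriv g z"
        by (metis DERIV_imp_deriv DERIV_cong_ev)
      have gz: "g z \<noteq> 0" using nz[OF z] g(2)[OF z(1)] by auto
      have "z * deriv p z = z * deriv f z / f z - 1"
        using fw[OF z(1)] ode[OF z(1)] z by (simp add: log_deriv_quot_def)
      also have "\<dots> = z * (deriv g z / g z)"
        using z gz by (simp add: df g(2) field_simps)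
      finally have "deriv g z = g z * deriv p z" using z gz by (simp add: field_simps)
      then show "((\<lambda>z. g z * exp (- p z)) has_field_derivative 0) (at z)"
        by (auto intro!: derivative_eq_intros dg dp')
    qed
  qed auto
  then obtain c where c: "\<And>z. norm z < 1 \<Longrightarrow> g z * exp (- p z) = c"
    by (auto simp: constant_on_def)
  have "c = 1" using c[of 0] g(3) hf(3) by (simp add: p_def)
  have ex: "quot_id f z = exp (p z)" if "norm z < 1" for z
    using c[OF that] \<open>c = 1\<close> by (simp add: gq[OF that] exp_minus field_simps)
  show ?thesis
    by (rule that[OF hp _ w(3) ode bound ex]) (auto simp: p_def)
qed

text \<open>Here \<open>z f'(z) / f z - 1 = z q'(z)\<close> is the dominant itself, so the identity serves as the Schwarz
  function.\<close>

lemma BS_extremal: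
  assumes s: "0 \<le> s" "s < 1"
  shows "(\<lambda>z. z * exp (scaled_artanh s z)) \<in> BS (s\<^sup>2)"
proof -
  let ?f = "\<lambda>z. z * exp (scaled_artanh s z)"
  let ?F = "\<lambda>z. z / (1 - of_real (s\<^sup>2) * z\<^sup>2) :: complex"
  have df: "(?f has_field_derivative exp (scaled_artanh s z) * (1 + ?F z)) (at z)" if "norm z < 1" for z
  proof -
    have "((\<lambda>z. exp (scaled_artanh s z)) has_field_derivative
        exp (scaled_artanh s z) * (1 / (1 - (of_real s)\<^sup>2 * z\<^sup>2))) (at z)"
      by (rule DERIV_chain2[OF DERIV_exp has_field_derivative_scaled_artanh[OF s that]])
    from DERIV_mult[OF DERIV_ident this] show ?thesis
      by (simp add: algebra_simps)
  qed
  have hol: "?f holomorphic_on ball 0 1"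
    by (rule holomorphic_on_ball_if_deriv) (rule df)
  have eq: "log_deriv_quot ?f z - 1 = ?F z" if "norm z < 1" for z
    using DERIV_imp_deriv[OF df[OF that]] by (simp add: log_deriv_quot_def)
  have hF: "?F holomorphic_on ball 0 1"
    using one_minus_scaled_square_nonzero[OF s] by (auto intro!: holomorphic_intros)
  have "(\<lambda>z. log_deriv_quot ?f z - 1) holomorphic_on ball 0 1"
    using holomorphic_transform[OF hF, of "\<lambda>z. log_deriv_quot ?f z - 1"] eq by simp
  then have "(\<lambda>z. log_deriv_quot ?f z - 1) \<prec> ?F"
    unfolding subordinate_def using hF eq by (auto intro!: exI[of _ "\<lambda>z. z"] holomorphic_intros)
  moreover have "?f \<in> class_A"
    using hol DERIV_imp_deriv[OF df[of 0]] by (simp add: class_A_def)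
  ultimately show ?thesis by (simp add: BS_def)
qed

section \<open>The real part of the dominant on a circle\<close>

text \<open>Write \<open>G = exp \<circ> scaled_artanh s\<close>. The derivative of \<open>Re (G (r e\<^sup>i\<^sup>t))\<close> in \<open>t\<close> is \<open>- Im (z G'(z))\<close>
  at \<open>z = r e\<^sup>i\<^sup>t\<close>, and \<open>z G'(z) = r exp (\<i> t + M z)\<close> for the branch \<open>M\<close> below of \<open>log G'\<close>. So the sign is that
  of \<open>sin (\<psi> t)\<close> with \<open>\<psi> t = t + Im (M z)\<close>. The derivative of \<open>\<psi>\<close> is the convexity expression
  \<open>Re (1 + z G''(z) / G'(z)) = Re ((1 + z + a z\<^sup>2) / (1 - a z\<^sup>2))\<close> with \<open>a = s\<^sup>2\<close>; after multiplication
  with \<open>\<bar>1 - a z\<^sup>2\<bar>\<^sup>2\<close> it becomes \<open>(1 - a r\<^sup>2) (1 + a r\<^sup>2 + Re z)\<close>, which is nonnegative. As \<open>M\<close> is real on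
  the real axis, \<open>\<psi>\<close> increases from \<open>0\<close> to \<open>\<pi>\<close> on the upper half circle and its sine is
  nonnegative.\<close>

lemma Re_exp_scaled_artanh_antimono:
  assumes s: "0 \<le> s" "s < 1" and r: "0 \<le> r" "r < 1"
    and t: "0 \<le> t1" "t1 \<le> t2" "t2 \<le> pi"
  shows "Re (exp (scaled_artanh s (of_real r * exp (\<i> * of_real t2))))
       \<le> Re (exp (scaled_artanh s (of_real r * exp (\<i> * of_real t1))))"
proof -
  let ?S = "(of_real s :: complex)\<^sup>2"
  define \<gamma> where "\<gamma> t = of_real r * exp (\<i> * of_real t)" for t :: real
  have n\<gamma>: "norm (\<gamma> t) = r" for t using r by (simp add: \<gamma>_def norm_mult)
  then have n1: "norm (\<gamma> t) < 1" for t using r by simp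
  have d\<gamma>: "(\<gamma> has_vector_derivative \<i> * \<gamma> t) (at t)" for t
    unfolding \<gamma>_def by (rule has_vector_derivative_circle)
  have den: "1 - ?S * (\<gamma> t)\<^sup>2 \<noteq> 0" for t
    by (rule one_minus_scaled_square_nonzero[OF s n1])
  define M where "M z = scaled_artanh s z - Ln (1 - ?S * z\<^sup>2)" for z
  define \<psi> where "\<psi> t = t + Im (M (\<gamma> t))" for t
  have dM: "(M has_field_derivative (1 + 2 * ?S * z) / (1 - ?S * z\<^sup>2)) (at z)" if z: "norm z < 1" for z
  proof -
    have "1 - ?S * z\<^sup>2 \<notin> \<real>\<^sub>\<le>\<^sub>0"
      using Re_one_plus_pos(2)[OF norm_scaled_less_one(2)[OF s z]]
      by (auto simp: complex_nonpos_Reals_iff)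
    then show ?thesis
      unfolding M_def using one_minus_scaled_square_nonzero[OF s z]
      by (auto intro!: derivative_eq_intros has_field_derivative_scaled_artanh s z simp: field_simps)
  qed
  have d\<psi>: "\<exists>y. (\<psi> has_real_derivative y) (at t) \<and> 0 \<le> y" for t
  proof -
    let ?z = "\<gamma> t"
    let ?Q = "?z * ((1 + 2 * ?S * ?z) / (1 - ?S * ?z\<^sup>2))"
    \<comment> \<open>The factor \<open>- \<i>\<close> expresses the imaginary part of \<open>M\<close> as a real part.\<close>
    have "((\<lambda>t. Re (- \<i> * M (\<gamma> t))) has_real_derivative
        Re ((\<i> * ?z) * (- \<i> * ((1 + 2 * ?S * ?z) / (1 - ?S * ?z\<^sup>2))))) (at t)"
      by (intro has_real_derivative_Re_comp[where H = "\<lambda>z. - \<i> * M z"] d\<gamma> DERIV_cmult dM n1)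
    moreover have "(\<i> * ?z) * (- \<i> * ((1 + 2 * ?S * ?z) / (1 - ?S * ?z\<^sup>2))) = ?Q"
      by (simp add: algebra_simps)
    moreover have "Re (- \<i> * M (\<gamma> t)) = Im (M (\<gamma> t))" for t
      by simp
    ultimately have "((\<lambda>t. Im (M (\<gamma> t))) has_real_derivative Re ?Q) (at t)"
      by (simp only:)
    then have "(\<psi> has_real_derivative 1 + Re ?Q) (at t)"
      unfolding \<psi>_def by (rule DERIV_add[OF DERIV_ident])
    moreover have "0 \<le> 1 + Re ?Q"
    proof -
      define a where "a = s\<^sup>2"
      have a: "0 \<le> a" "a < 1" using s by (auto simp: a_def power_less_one_iff)
      have zz: "?z * cnj ?z = of_real (r\<^sup>2)" using complex_norm_square[of ?z] by (simp add: n\<gamma>)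
      have "1 + ?Q = (1 + ?z + of_real a * ?z\<^sup>2) / (1 - of_real a * ?z\<^sup>2)"
        using den[of t] by (simp add: a_def field_simps power2_eq_square)
      also have "\<dots> = ((1 + ?z + of_real a * ?z\<^sup>2) * cnj (1 - of_real a * ?z\<^sup>2)) / of_real ((norm (1 - of_real a * ?z\<^sup>2))\<^sup>2)"
        by (rule complex_div_cnj)
      finally have 1: "1 + Re ?Q = Re ((1 + ?z + of_real a * ?z\<^sup>2) * cnj (1 - of_real a * ?z\<^sup>2)) / (norm (1 - of_real a * ?z\<^sup>2))\<^sup>2"
        by (metis Re_divide_of_real plus_complex.sel(1) one_complex.sel(1))
      have "(1 + ?z + of_real a * ?z\<^sup>2) * cnj (1 - of_real a * ?z\<^sup>2)
          = 1 + ?z + of_real a * (?z\<^sup>2 - cnj (?z\<^sup>2)) - of_real a * (?z * cnj ?z) * cnj ?z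
            - (of_real a)\<^sup>2 * (?z * cnj ?z)\<^sup>2"
        by (simp add: algebra_simps power2_eq_square)
      then have "Re ((1 + ?z + of_real a * ?z\<^sup>2) * cnj (1 - of_real a * ?z\<^sup>2))
          = Re (1 + ?z + of_real a * (?z\<^sup>2 - cnj (?z\<^sup>2)) - of_real (a * r\<^sup>2) * cnj ?z - of_real ((a * r\<^sup>2)\<^sup>2))"
        unfolding zz by (simp add: power_mult_distrib)
      also have "\<dots> = (1 - a * r\<^sup>2) * (1 + a * r\<^sup>2 + Re ?z)"
        by (simp add: algebra_simps power2_eq_square)
      also have "\<dots> \<ge> 0"
      proof (intro mult_nonneg_nonneg)
        show "0 \<le> 1 - a * r\<^sup>2" using a r by (simp add: mult_le_one power_le_one)
        show "0 \<le> 1 + a * r\<^sup>2 + Re ?z"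
        proof -
          have "0 \<le> a * r\<^sup>2" using a by simp
          moreover have "- r \<le> Re ?z" using abs_Re_le_cmod[of ?z] n\<gamma>[of t] by simp
          ultimately show ?thesis using r by linarith
        qed
      qed
      finally show ?thesis unfolding 1 by simp
    qed
    ultimately show ?thesis by blast
  qed
  have M_real: "Im (M (of_real x)) = 0" if "\<bar>x\<bar> < 1" for x
  proof -
    have "norm ((of_real s)\<^sup>2 * (complex_of_real x)\<^sup>2) < 1"
      by (rule norm_scaled_less_one) (use s that in auto)
    then have "\<bar>s\<^sup>2 * x\<^sup>2\<bar> < 1" by (simp add: norm_mult norm_power abs_mult)
    then show ?thesis
      using scaled_artanh_of_real(1)[OF s that] Ln_of_real[of "1 - s\<^sup>2 * x\<^sup>2"] by (simp add: M_def)
  qed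
  have \<psi>0: "\<psi> 0 = 0" using M_real[of r] r by (simp add: \<psi>_def \<gamma>_def)
  have "\<gamma> pi = of_real (- r)" by (simp add: \<gamma>_def)
  then have \<psi>pi: "\<psi> pi = pi" using M_real[of "- r"] r by (simp add: \<psi>_def)
  have sin: "0 \<le> sin (\<psi> t)" if "0 \<le> t" "t \<le> pi" for t
    using DERIV_nonneg_imp_nondecreasing[OF that(1), of \<psi>] DERIV_nonneg_imp_nondecreasing[OF that(2), of \<psi>]
      d\<psi> by (intro sin_ge_zero) (auto simp: \<psi>0 \<psi>pi)
  have "Re (exp (scaled_artanh s (\<gamma> t2))) \<le> Re (exp (scaled_artanh s (\<gamma> t1)))"
  proof (rule DERIV_nonpos_imp_nonincreasing[OF t(2)])
    fix t assume "t1 \<le> t" "t \<le> t2"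
    then have tt: "0 \<le> t" "t \<le> pi" using t by auto
    let ?z = "\<gamma> t"
    let ?G = "exp (scaled_artanh s ?z) * (1 / (1 - ?S * ?z\<^sup>2))"
    have 1: "((\<lambda>t. Re (exp (scaled_artanh s (\<gamma> t)))) has_real_derivative Re ((\<i> * ?z) * ?G)) (at t)"
      by (rule has_real_derivative_Re_comp[where H = "\<lambda>z. exp (scaled_artanh s z)", OF _ d\<gamma>])
         (rule DERIV_chain2[OF DERIV_exp has_field_derivative_scaled_artanh[OF s n1]])
    have "exp (M ?z) = ?G"
      using den[of t] by (simp add: M_def exp_diff)
    then have "?z * ?G = of_real r * exp (\<i> * of_real t + M ?z)"
      by (simp add: \<gamma>_def exp_add)
    then have "Im (?z * ?G) = r * (exp (Re (M ?z)) * sin (\<psi> t))"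
      by (simp add: Im_exp \<psi>_def)
    moreover have "Re ((\<i> * ?z) * ?G) = - Im (?z * ?G)"
      using Re_i_times[of "?z * ?G"] by (simp only: mult.assoc)
    ultimately have "Re ((\<i> * ?z) * ?G) \<le> 0" using sin[OF tt] r by simp
    with 1 show "\<exists>y. ((\<lambda>t. Re (exp (scaled_artanh s (\<gamma> t)))) has_real_derivative y) (at t) \<and> y \<le> 0"
      by blast
  qed
  then show ?thesis by (simp add: \<gamma>_def)
qed

lemma cnj_scaled_artanh:
  assumes "0 \<le> s" "s < 1" "norm z < 1"
  shows "scaled_artanh s (cnj z) = cnj (scaled_artanh s z)"
proof -
  have pos: "0 < Re (1 + of_real s * z)" "0 < Re (1 - of_real s * z)"
    by (intro Re_one_plus_pos norm_scaled_less_one assms)+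
  have "1 + of_real s * z \<notin> \<real>\<^sub>\<le>\<^sub>0" "1 - of_real s * z \<notin> \<real>\<^sub>\<le>\<^sub>0"
    using pos by (auto simp: complex_nonpos_Reals_iff)
  from this[THEN cnj_Ln] show ?thesis by (simp add: scaled_artanh_def)
qed

text \<open>The monotonicity covers the upper half circle; conjugation carries it to the lower one.\<close>

lemma Re_exp_scaled_artanh_bounds:
  assumes s: "0 \<le> s" "s < 1" and z: "norm z = \<rho>" "\<rho> < 1"
  shows "BS_upper (s\<^sup>2) (- \<rho>) \<le> Re (exp (scaled_artanh s z))"
    and "Re (exp (scaled_artanh s z)) \<le> BS_upper (s\<^sup>2) \<rho>"
proof -
  have \<rho>: "0 \<le> \<rho>" "\<bar>\<rho>\<bar> < 1" "\<bar>- \<rho>\<bar> < 1" using z by auto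
  have upper_half: "BS_upper (s\<^sup>2) (- \<rho>) \<le> Re (exp (scaled_artanh s u)) \<and>
      Re (exp (scaled_artanh s u)) \<le> BS_upper (s\<^sup>2) \<rho>" if u: "norm u = \<rho>" "0 \<le> Im u" for u
  proof -
    have "u = of_real \<rho> * exp (\<i> * of_real (Arg u))"
    proof (cases "u = 0")
      case False then show ?thesis using Arg_eq[of u] u by simp
    qed (use u in simp)
    moreover have "0 \<le> Arg u" "Arg u \<le> pi"
      using u Arg_le_pi Arg_less_0[of u] by auto
    ultimately show ?thesis
      using Re_exp_scaled_artanh_antimono[OF s \<rho>(1) z(2), of 0 "Arg u"]
        Re_exp_scaled_artanh_antimono[OF s \<rho>(1) z(2), of "Arg u" pi]
        scaled_artanh_of_real(2)[OF s \<rho>(2)] scaled_artanh_of_real(2)[OF s \<rho>(3)]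
      by simp
  qed
  have "BS_upper (s\<^sup>2) (- \<rho>) \<le> Re (exp (scaled_artanh s z)) \<and>
      Re (exp (scaled_artanh s z)) \<le> BS_upper (s\<^sup>2) \<rho>"
  proof (cases "0 \<le> Im z")
    case False
    have "exp (scaled_artanh s (cnj z)) = cnj (exp (scaled_artanh s z))"
      using z by (simp add: cnj_scaled_artanh[OF s] exp_cnj)
    then show ?thesis using upper_half[of "cnj z"] z False by simp
  qed (use upper_half z in auto)
  then show "BS_upper (s\<^sup>2) (- \<rho>) \<le> Re (exp (scaled_artanh s z))"
    and "Re (exp (scaled_artanh s z)) \<le> BS_upper (s\<^sup>2) \<rho>" by auto
qed

section \<open>The sharp bounds\<close>

text \<open>The bounds at \<open>\<omega> z\<close> are weakened to those at \<open>z\<close> by \<open>\<bar>\<omega> z\<bar> \<le> \<bar>z\<bar>\<close> and monotonicity.\<close>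

lemma BS_Re_quot_id_bounds:
  assumes f: "f \<in> BS (s\<^sup>2)" and s: "0 \<le> s" "s \<le> sqrt 2 - 1" and z: "norm z < 1"
  shows "BS_upper (s\<^sup>2) (- norm z) \<le> Re (quot_id f z)"
    and "Re (quot_id f z) \<le> BS_upper (s\<^sup>2) (norm z)"
proof -
  have s1: "s < 1" using s sqrt2_less_2 by linarith
  \<comment> \<open>The hypothesis on \<open>s\<close> in the form that bounds \<open>2 s p\<close>.\<close>
  have "(s + 1)\<^sup>2 \<le> (sqrt 2)\<^sup>2" using s by (intro power_mono) auto
  then have s2: "2 * s \<le> 1 - s\<^sup>2" by (simp add: power2_eq_square algebra_simps)
  have pos: "0 < 1 - s\<^sup>2" using s(1) s1 by (simp add: power_less_one_iff)
  obtain p w where p: "p holomorphic_on ball 0 1" "p 0 = 0"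
    "\<And>z. norm z < 1 \<Longrightarrow> norm (w z) < 1"
    "\<And>z. norm z < 1 \<Longrightarrow> z * deriv p z = w z / (1 - (of_real s)\<^sup>2 * (w z)\<^sup>2)"
    and bound: "\<And>z. norm z < 1 \<Longrightarrow> norm (p z) \<le> norm z / (1 - s\<^sup>2)"
    and ex: "\<And>z. norm z < 1 \<Longrightarrow> quot_id f z = exp (p z)"
    using BS_logarithm[OF f s(1) s1] by blast
  have small: "norm (2 * of_real s * p z) < pi" if "norm z < 1" for z
  proof -
    have "norm (2 * of_real s * p z) = (2 * s) * norm (p z)" using s by (simp add: norm_mult)
    also have "\<dots> \<le> (1 - s\<^sup>2) * (norm z / (1 - s\<^sup>2))"
      using s2 bound[OF that] s pos by (intro mult_mono) auto
    also have "\<dots> < pi" using pos that pi_gt3 by simp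
    finally show ?thesis .
  qed
  obtain \<omega> where \<omega>: "\<And>z. norm z < 1 \<Longrightarrow> norm (\<omega> z) \<le> norm z"
    "\<And>z. norm z < 1 \<Longrightarrow> p z = scaled_artanh s (\<omega> z)"
    using subordinate_scaled_artanh[OF s(1) s1 p small] by blast
  have le: "norm (\<omega> z) \<le> norm z" and lt: "norm (\<omega> z) < 1" using \<omega>(1)[OF z] z by auto
  have q: "quot_id f z = exp (scaled_artanh s (\<omega> z))" using ex[OF z] \<omega>(2)[OF z] by simp
  note b = Re_exp_scaled_artanh_bounds[OF s(1) s1 refl lt]
  show "BS_upper (s\<^sup>2) (- norm z) \<le> Re (quot_id f z)"
    using order_trans[OF BS_upper_mono[OF s(1) s1, of "- norm z" "- norm (\<omega> z)"] b(1)] le lt z q by simp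
  show "Re (quot_id f z) \<le> BS_upper (s\<^sup>2) (norm z)"
    using order_trans[OF b(2) BS_upper_mono[OF s(1) s1, of "norm (\<omega> z)" "norm z"]] le lt z q by simp
qed

theorem theorem2p6:
  fixes \<alpha> :: real
  assumes "0 \<le> \<alpha>" and "\<alpha> \<le> 3 - 2 * sqrt 2"
  shows "(\<forall>f\<in>BS \<alpha>. \<forall>(z::complex) r. norm z = r \<longrightarrow> r < 1 \<longrightarrow>
            BS_lower \<alpha> r \<le> Re (quot_id f z) \<and> Re (quot_id f z) \<le> BS_upper \<alpha> r) \<and>
         (\<forall>r. 0 \<le> r \<longrightarrow> r < 1 \<longrightarrow>
            (\<exists>f\<in>BS \<alpha>. \<exists>z. norm z = r \<and> Re (quot_id f z) = BS_lower \<alpha> r) \<and>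
            (\<exists>f\<in>BS \<alpha>. \<exists>z. norm z = r \<and> Re (quot_id f z) = BS_upper \<alpha> r))"
proof -
  define s where "s = sqrt \<alpha>"
  have \<alpha>: "\<alpha> = s\<^sup>2" unfolding s_def using assms(1) by simp
  have s0: "0 \<le> s" unfolding s_def using assms(1) by simp
  have "(sqrt 2 - 1)\<^sup>2 = 3 - 2 * sqrt 2" by (simp add: power2_eq_square algebra_simps)
  then have "s\<^sup>2 \<le> (sqrt 2 - 1)\<^sup>2"
    using assms(2) \<alpha> by simp
  then have s: "s \<le> sqrt 2 - 1"
    by (rule power2_le_imp_le) simp
  then have s1: "s < 1" using sqrt2_less_2 by linarith
  let ?f = "\<lambda>z. z * exp (scaled_artanh s z)"
  have f: "?f \<in> BS \<alpha>" unfolding \<alpha> by (rule BS_extremal[OF s0 s1])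
  have val: "Re (quot_id ?f (of_real x)) = BS_upper \<alpha> x" if "\<bar>x\<bar> < 1" for x
  proof -
    have "quot_id ?f (of_real x) = exp (scaled_artanh s (of_real x))"
      by (simp add: quot_id_def)
    then show ?thesis using scaled_artanh_of_real(2)[OF s0 s1 that] by (simp add: \<alpha>)
  qed
  have "\<exists>f\<in>BS \<alpha>. \<exists>z. norm z = r \<and> Re (quot_id f z) = BS_lower \<alpha> r"
       "\<exists>f\<in>BS \<alpha>. \<exists>z. norm z = r \<and> Re (quot_id f z) = BS_upper \<alpha> r" if r: "0 \<le> r" "r < 1" for r
  proof -
    show "\<exists>f\<in>BS \<alpha>. \<exists>z. norm z = r \<and> Re (quot_id f z) = BS_lower \<alpha> r"
    proof (intro bexI[OF _ f] exI conjI)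
      show "norm (complex_of_real (- r)) = r" using r by simp
      show "Re (quot_id ?f (of_real (- r))) = BS_lower \<alpha> r"
        unfolding BS_lower_eq_upper by (rule val) (use r in simp)
    qed
    show "\<exists>f\<in>BS \<alpha>. \<exists>z. norm z = r \<and> Re (quot_id f z) = BS_upper \<alpha> r"
    proof (intro bexI[OF _ f] exI conjI)
      show "norm (complex_of_real r) = r" using r by simp
      show "Re (quot_id ?f (of_real r)) = BS_upper \<alpha> r"
        by (rule val) (use r in simp)
    qed
  qed
  moreover have "BS_lower \<alpha> r \<le> Re (quot_id f z) \<and> Re (quot_id f z) \<le> BS_upper \<alpha> r"
    if "f \<in> BS \<alpha>" "norm z = r" "r < 1" for f z r
    using BS_Re_quot_id_bounds[OF _ s0 s, of f z] that unfolding \<alpha> BS_lower_eq_upper by simp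
  ultimately show ?thesis by blast
qed

end
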